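(* Let $k\in\mathbb N^+$ and let $H$ be a $k$-monoid generated by $h_1,h_2,\ldots,h_r$ (all nonzero). Then $\mathrm{ind}\,H=1$ if and only if $h_1,h_2,\ldots,h_r$ have the same primitive part.
   Context: $\mathbb N=\{0,1,2,\ldots\}$, $\mathbb N^+=\mathbb N\setminus\{0\}$. A $k$-monoid is a submonoid of $(\mathbb N^k,+)$, with zero element $0_k$. An isomorphism between a $k$-monoid and an $l$-monoid is a bijective additive map; $\cong$ denotes isomorphism. $\mathrm{ind}\,H=\min\{r\in\mathbb N^+: H\cong K\text{ for some }r\text{-monoid }K\}$. An element $h=(h(1),\ldots,h(k))\in\mathbb N^k\setminus\{0_k\}$ is primitive if $\gcd(h(1),\ldots,h(k))=1$. For $h\in\mathbb N^k\setminus\{0_k\}$, put $c_h=\gcd(h(1),\ldots,h(k))$; the primitive part of $h$ is the element $g_h\in\mathbb N^k$ with $g_h(i)=h(i)/c_h$ for all $i$, i.e. the unique primitive $g_h$ such that $h=c\,g_h$ for some $c\in\mathbb N^+$. *)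

theory Defs
  imports "HOL-Algebra.Group" "HOL.Hull" "HOL.GCD"
begin

(* A vector of \<nat>^k is a function nat \<Rightarrow> nat vanishing outside the k coordinates {..<k}, so that
   the dimension k can be quantified over. The operation (\<otimes> of the record) is pointwise addition. *)

definition add_on :: "(nat \<Rightarrow> nat) set \<Rightarrow> (nat \<Rightarrow> nat) monoid" where
  "add_on H = \<lparr>carrier = H, mult = (\<lambda>x y i. x i + y i), one = (\<lambda>i. 0)\<rparr>"

definition nat_vecs :: "nat \<Rightarrow> (nat \<Rightarrow> nat) set" where
  "nat_vecs k = {x. \<forall>i\<ge>k. x i = 0}"

definition k_monoid :: "nat \<Rightarrow> (nat \<Rightarrow> nat) set \<Rightarrow> bool" where
  "k_monoid k H \<longleftrightarrow> submonoid H (add_on (nat_vecs k))"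

(* A bijection respecting the operation preserves the unit here, because \<nat>^k is cancellative;
   so the library relation \<cong> is the isomorphism of monoids. For a k-monoid H with k \<ge> 1, r = k
   satisfies the condition, so LEAST is a genuine minimum. *)
definition ind :: "(nat \<Rightarrow> nat) set \<Rightarrow> nat" where
  "ind H = (LEAST r. r \<ge> 1 \<and> (\<exists>K. k_monoid r K \<and> add_on H \<cong> add_on K))"

(* The k-monoid generated by S, for S \<subseteq> nat_vecs k, is the least k-monoid containing S.
   (If S is not contained in nat_vecs k, the hull is UNIV.) *)
definition generated :: "nat \<Rightarrow> (nat \<Rightarrow> nat) set \<Rightarrow> (nat \<Rightarrow> nat) set" where
  "generated k S = k_monoid k hull S"

(* Meaningful for nonzero h in nat_vecs k, where the gcd is positive and the division is exact. *)
definition primitive_part :: "nat \<Rightarrow> (nat \<Rightarrow> nat) \<Rightarrow> nat \<Rightarrow> nat" where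
  "primitive_part k h = (\<lambda>i. h i div Gcd (h ` {..<k}))"

end

theory Submission
  imports Defs
begin

text \<open>
  The index of \<open>H\<close> is 1 exactly when \<open>H\<close> is isomorphic to a submonoid of \<open>\<nat>\<close>.

  In \<open>\<nat>\<close> any two nonzero numbers \<open>a\<close>, \<open>b\<close> have a common nonzero multiple: \<open>b \<cdot> a = a \<cdot> b\<close>. An
  isomorphism transports this relation back, so any two nonzero elements of \<open>H\<close> have equal nonzero
  multiples (\<open>commensurable_if_numerical\<close>). As the primitive part of a vector does not change when
  the vector is multiplied by a positive number (\<open>primitive_part_scale\<close>), all nonzero elements of
  \<open>H\<close>, in particular the generators, have the same primitive part.

  Conversely, if all generators have the primitive part \<open>g\<close>, they are multiples of \<open>g\<close>, and hence so
  are all elements of \<open>H\<close>. Sending \<open>n \<cdot> g\<close> to \<open>n\<close> then identifies \<open>H\<close> with a submonoid of \<open>\<nat>\<close>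
  (\<open>numerical_if_on_ray\<close>).
\<close>

lemma k_monoid_iff:
  "k_monoid k H \<longleftrightarrow> H \<subseteq> nat_vecs k \<and> (\<lambda>i. 0) \<in> H \<and> (\<forall>x\<in>H. \<forall>y\<in>H. (\<lambda>i. x i + y i) \<in> H)"
  by (auto simp: k_monoid_def submonoid_def add_on_def)

lemma add_on_is_iso_iff:
  "add_on H \<cong> add_on K \<longleftrightarrow>
    (\<exists>f. bij_betw f H K \<and> (\<forall>x\<in>H. \<forall>y\<in>H. f (\<lambda>i. x i + y i) = (\<lambda>i. f x i + f y i)))"
proof -
  have "f \<in> iso (add_on H) (add_on K) \<longleftrightarrow>
      bij_betw f H K \<and> (\<forall>x\<in>H. \<forall>y\<in>H. f (\<lambda>i. x i + y i) = (\<lambda>i. f x i + f y i))" for f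
    by (auto simp: iso_def hom_def add_on_def bij_betw_def)
  then show ?thesis
    unfolding is_iso_def by blast
qed

lemma generated_superset: "S \<subseteq> generated k S"
  unfolding generated_def by (rule hull_subset)

lemma generated_minimal: "S \<subseteq> M \<Longrightarrow> k_monoid k M \<Longrightarrow> generated k S \<subseteq> M"
  unfolding generated_def by (rule hull_minimal)

text \<open>
  A minimum over the empty set would be an arbitrary value; here \<open>H\<close> itself, in dimension \<open>k\<close>,
  shows that the minimum exists.
\<close>

lemma ind_eq_1_iff:
  assumes "k \<ge> 1" and "k_monoid k H"
  shows "ind H = 1 \<longleftrightarrow> (\<exists>K. k_monoid 1 K \<and> add_on H \<cong> add_on K)"
proof
  have "add_on H \<cong> add_on H"
    unfolding add_on_is_iso_iff by (rule exI[of _ id]) simp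
  then have "k \<ge> 1 \<and> (\<exists>K. k_monoid k K \<and> add_on H \<cong> add_on K)"
    using assms by blast
  then have "ind H \<ge> 1 \<and> (\<exists>K. k_monoid (ind H) K \<and> add_on H \<cong> add_on K)"
    unfolding ind_def by (rule LeastI)
  then show "\<exists>K. k_monoid 1 K \<and> add_on H \<cong> add_on K" if "ind H = 1"
    using that by simp
next
  assume "\<exists>K. k_monoid 1 K \<and> add_on H \<cong> add_on K"
  then show "ind H = 1"
    unfolding ind_def by (intro Least_equality) auto
qed

section \<open>Primitive parts\<close>

lemma primitive_part_scale:
  assumes "c > 0"
  shows "primitive_part k (\<lambda>i. c * x i) = primitive_part k x"
proof -
  have "Gcd ((\<lambda>i. c * x i) ` {..<k}) = c * Gcd (x ` {..<k})"
    using Gcd_mult[of c "x ` {..<k}"] by (simp add: image_image)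
  then show ?thesis
    using assms by (simp add: primitive_part_def)
qed

lemma eq_Gcd_times_primitive_part:
  assumes "x \<in> nat_vecs k"
  shows "x = (\<lambda>i. Gcd (x ` {..<k}) * primitive_part k x i)"
proof
  fix i
  have "Gcd (x ` {..<k}) dvd x i"
    using assms by (cases "i < k") (auto simp: nat_vecs_def intro: Gcd_dvd)
  then show "x i = Gcd (x ` {..<k}) * primitive_part k x i"
    by (simp add: primitive_part_def)
qed

section \<open>Submonoids of the natural numbers\<close>

lemma scale_closed:
  assumes "k_monoid k H" and "x \<in> H"
  shows "(\<lambda>i. n * x i) \<in> H"
  using assms by (induction n) (auto simp: k_monoid_iff)

text \<open>
  If \<open>f\<close> sends \<open>x\<close> to \<open>a\<close> and \<open>y\<close> to \<open>b\<close>, it sends both \<open>b \<cdot> x\<close> and \<open>a \<cdot> y\<close> to the product of \<open>a\<close>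
  and \<open>b\<close>, and \<open>f\<close> is injective.
\<close>

lemma commensurable_if_numerical:
  assumes H: "k_monoid k H" and K: "k_monoid 1 K" and iso: "add_on H \<cong> add_on K"
    and x: "x \<in> H" "x \<noteq> (\<lambda>i. 0)" and y: "y \<in> H" "y \<noteq> (\<lambda>i. 0)"
  shows "\<exists>a b. a > 0 \<and> b > 0 \<and> (\<lambda>i. b * x i) = (\<lambda>i. a * y i)"
proof -
  obtain f where bij: "bij_betw f H K"
    and add: "\<And>u v. u \<in> H \<Longrightarrow> v \<in> H \<Longrightarrow> f (\<lambda>i. u i + v i) = (\<lambda>i. f u i + f v i)"
    using iso unfolding add_on_is_iso_iff by blast
  have zero: "(\<lambda>i. 0) \<in> H"
    using H by (simp add: k_monoid_iff)
  \<comment> \<open>Elements of a 1-monoid are determined by their coordinate 0.\<close>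
  have inj: "u = v" if "u \<in> H" "v \<in> H" "f u 0 = f v 0" for u v
  proof -
    have "f u \<in> nat_vecs 1" "f v \<in> nat_vecs 1"
      using bij K that by (auto simp: k_monoid_iff bij_betw_def)
    then have "f u i = f v i" for i
      using that by (cases "i = 0") (auto simp: nat_vecs_def)
    then have "f u = f v" ..
    then show ?thesis
      using bij that by (meson bij_betw_def inj_onD)
  qed
  have f_zero: "f (\<lambda>i. 0) 0 = 0"
    using fun_cong[OF add[OF zero zero], of 0] by simp
  have f_scale: "f (\<lambda>i. n * u i) 0 = n * f u 0" if "u \<in> H" for n u
  proof (induction n)
    case 0
    then show ?case using f_zero by simp
  next
    case (Suc n)
    then show ?case
      using add[OF that scale_closed[OF H that, of n]] by simp
  qed
  have "f x 0 > 0" "f y 0 > 0"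
    using inj[OF _ zero] x y f_zero by auto
  moreover have "(\<lambda>i. f y 0 * x i) = (\<lambda>i. f x 0 * y i)"
    using x y by (intro inj scale_closed[OF H]) (simp_all add: f_scale)
  ultimately show ?thesis by blast
qed

text \<open>
  The number \<open>n\<close> is recovered from \<open>n \<cdot> g\<close> by a division in any coordinate in which \<open>g\<close> does not
  vanish.
\<close>

lemma numerical_if_on_ray:
  assumes H: "k_monoid k H" and "g \<noteq> (\<lambda>i. 0)" and ray: "H \<subseteq> range (\<lambda>n i. n * g i)"
  shows "\<exists>K. k_monoid 1 K \<and> add_on H \<cong> add_on K"
proof -
  obtain p where p: "g p > 0"
    using \<open>g \<noteq> (\<lambda>i. 0)\<close> by auto
  define f where "f x = (\<lambda>i::nat. if i = 0 then x p div g p else 0)" for x :: "nat \<Rightarrow> nat"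
  have f_ray: "f (\<lambda>i. n * g i) = (\<lambda>i. if i = 0 then n else 0)" for n
    using p by (auto simp: f_def)
  have add: "f (\<lambda>i. x i + y i) = (\<lambda>i. f x i + f y i)" if xy: "x \<in> H" "y \<in> H" for x y
  proof -
    obtain m n where "x = (\<lambda>i. m * g i)" "y = (\<lambda>i. n * g i)"
      using ray xy by blast
    then show ?thesis
      using f_ray[of "m + n"] by (auto simp: f_ray algebra_simps)
  qed
  have "inj_on f H"
  proof (rule inj_onI)
    fix x y
    assume "x \<in> H" "y \<in> H" and eq: "f x = f y"
    then obtain m n where "x = (\<lambda>i. m * g i)" "y = (\<lambda>i. n * g i)"
      using ray by blast
    then show "x = y"
      using fun_cong[OF eq, of 0] by (simp add: f_ray)
  qed
  then have "add_on H \<cong> add_on (f ` H)"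
    unfolding add_on_is_iso_iff using add by (auto intro!: exI[of _ f] simp: bij_betw_def)
  moreover have "k_monoid 1 (f ` H)"
    unfolding k_monoid_iff
  proof (intro conjI ballI)
    show "f ` H \<subseteq> nat_vecs 1"
      by (auto simp: f_def nat_vecs_def)
    have "(\<lambda>i. 0) \<in> H"
      using H by (simp add: k_monoid_iff)
    moreover have "f (\<lambda>i. 0) = (\<lambda>i. 0)"
      by (auto simp: f_def)
    ultimately show "(\<lambda>i. 0) \<in> f ` H"
      by force
  next
    fix u v
    assume "u \<in> f ` H" "v \<in> f ` H"
    then obtain x y where "x \<in> H" "y \<in> H" "u = f x" "v = f y"
      by blast
    moreover from this have "(\<lambda>i. x i + y i) \<in> H"
      using H by (simp add: k_monoid_iff)
    ultimately show "(\<lambda>i. u i + v i) \<in> f ` H"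
      using add by (auto intro!: image_eqI[of _ f "\<lambda>i. x i + y i"])
  qed
  ultimately show ?thesis by blast
qed

lemma k_monoid_ray:
  assumes "g \<in> nat_vecs k"
  shows "k_monoid k (range (\<lambda>n i. n * g i))"
proof -
  have "(\<lambda>i. m * g i + n * g i) \<in> range (\<lambda>n i. n * g i)" for m n
    by (rule image_eqI[of _ _ "m + n"]) (simp_all add: algebra_simps)
  moreover have "(\<lambda>i. 0) \<in> range (\<lambda>n i. n * g i)"
    by (rule image_eqI[of _ _ 0]) simp_all
  ultimately show ?thesis
    using assms by (auto simp: k_monoid_iff nat_vecs_def)
qed

section \<open>Monoids of index 1\<close>

theorem proposition3p3:
  fixes k r :: nat
    and H :: "(nat \<Rightarrow> nat) set"
    and h :: "nat \<Rightarrow> nat \<Rightarrow> nat"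
  assumes "k \<ge> 1"
    and "k_monoid k H"
    and "\<And>j. j \<in> {1..r} \<Longrightarrow> h j \<in> nat_vecs k \<and> h j \<noteq> (\<lambda>i. 0)"
    and "H = generated k (h ` {1..r})"
  shows "ind H = 1 \<longleftrightarrow>
    (\<forall>j\<in>{1..r}. \<forall>l\<in>{1..r}. primitive_part k (h j) = primitive_part k (h l))"
proof -
  have "(\<exists>K. k_monoid 1 K \<and> add_on H \<cong> add_on K) \<longleftrightarrow>
    (\<forall>j\<in>{1..r}. \<forall>l\<in>{1..r}. primitive_part k (h j) = primitive_part k (h l))"
  proof (intro iffI ballI)
    fix j l
    assume "\<exists>K. k_monoid 1 K \<and> add_on H \<cong> add_on K" and jl: "j \<in> {1..r}" "l \<in> {1..r}"
    then obtain K where "k_monoid 1 K" "add_on H \<cong> add_on K"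
      by blast
    moreover have "h j \<in> H" "h l \<in> H"
      using jl generated_superset assms(4) by blast+
    ultimately obtain a b where "a > 0" "b > 0" "(\<lambda>i. b * h j i) = (\<lambda>i. a * h l i)"
      using commensurable_if_numerical[OF assms(2)] assms(3) jl by metis
    then show "primitive_part k (h j) = primitive_part k (h l)"
      by (metis primitive_part_scale)
  next
    assume same: "\<forall>j\<in>{1..r}. \<forall>l\<in>{1..r}. primitive_part k (h j) = primitive_part k (h l)"
    obtain g where g: "g \<in> nat_vecs k" "g \<noteq> (\<lambda>i. 0)"
      and gens: "h ` {1..r} \<subseteq> range (\<lambda>n i. n * g i)"
    proof (cases "r = 0")
      case True
      \<comment> \<open>Without generators, \<open>H\<close> is trivial and lies on every ray; a unit vector spans one.\<close>
      show thesis
      proof (rule that)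
        show "(\<lambda>i. if i = 0 then 1 else 0) \<in> nat_vecs k"
          using \<open>k \<ge> 1\<close> by (auto simp: nat_vecs_def)
        show "(\<lambda>i::nat. if i = 0 then 1 else 0::nat) \<noteq> (\<lambda>i. 0)"
          by (auto dest: fun_cong[of _ _ 0])
      qed (use True in simp)
    next
      case False
      define g where "g = primitive_part k (h 1)"
      have h: "h j = (\<lambda>i. Gcd (h j ` {..<k}) * g i)" if "j \<in> {1..r}" for j
      proof -
        have "1 \<in> {1..r}"
          using False by simp
        with same that have "g = primitive_part k (h j)"
          unfolding g_def by blast
        then show ?thesis
          using assms(3)[OF that] by (simp only: eq_Gcd_times_primitive_part[symmetric])
      qed
      show thesis
      proof (rule that)
        have h1: "h 1 \<in> nat_vecs k" "h 1 \<noteq> (\<lambda>i. 0)"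
          using assms(3)[of 1] False by auto
        show "g \<in> nat_vecs k"
          using h1 by (simp add: g_def primitive_part_def nat_vecs_def)
        show "g \<noteq> (\<lambda>i. 0)"
        proof
          assume "g = (\<lambda>i. 0)"
          then have "(\<lambda>i. Gcd (h 1 ` {..<k}) * g i) = (\<lambda>i. 0)"
            by simp
          moreover have "h 1 = (\<lambda>i. Gcd (h 1 ` {..<k}) * g i)"
            using False by (intro h) simp
          ultimately show False
            using h1(2) by metis
        qed
        show "h ` {1..r} \<subseteq> range (\<lambda>n i. n * g i)"
          using h by blast
      qed
    qed
    have "H \<subseteq> range (\<lambda>n i. n * g i)"
      unfolding assms(4) by (rule generated_minimal[OF gens k_monoid_ray[OF g(1)]])
    then show "\<exists>K. k_monoid 1 K \<and> add_on H \<cong> add_on K"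
      by (rule numerical_if_on_ray[OF assms(2) g(2)])
  qed
  then show ?thesis
    using ind_eq_1_iff[OF assms(1,2)] by simp
qed

end
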